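(* For integers $2\le n\le m$, $\gamma_P(K_n\Box K_m)=n-1$. For integers $1\le n\le m$, $\operatorname{th}_{\rm pd}^{\times}(K_n\Box K_m)=\gamma(K_n\Box K_m)=n$.
   Context: All graphs are finite, simple and undirected. $K_n$ is the complete graph on $n$ vertices. The Cartesian product $G\Box H$ has vertex set $V(G)\times V(H)$, with $(x_1,y_1)$ and $(x_2,y_2)$ adjacent if either $x_1=x_2$ and $y_1y_2\in E(H)$, or $y_1=y_2$ and $x_1x_2\in E(G)$. Let $G$ be a graph. $\gamma(G)$ is the domination number: the minimum $|S|$ over $S\subseteq V(G)$ with $N[S]=V(G)$, where $N[S]$ is the closed neighborhood of $S$. For nonempty $S\subseteq V(G)$ define $P^{[0]}(S)=S$, $P^{[1]}(S)=N[S]$, and for $i\ge 1$, $P^{[i+1]}(S)=P^{[i]}(S)\cup\{w\in V(G)\setminus P^{[i]}(S): \exists u\in P^{[i]}(S),\ N(u)\setminus P^{[i]}(S)=\{w\}\}$. $S$ is a power dominating set if $P^{[t]}(S)=V(G)$ for some $t$; the power domination number $\gamma_P(G)$ is the minimum cardinality of a power dominating set. The power propagation time $\operatorname{pt}_{\rm pd}(G;S)$ is the least positive integer $t$ with $P^{[t]}(S)=V(G)$ (so it is at least $1$, even for $S=V(G)$), and is $\infty$ if $S$ is not a power dominating set. The product power throttling number is $\operatorname{th}_{\rm pd}^{\times}(G)=\min_{\emptyset\ne S\subseteq V(G)}|S|\operatorname{pt}_{\rm pd}(G;S)$. *)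

theory Defs
  imports "Graph_Theory.Graph_Theory" "HOL-Library.Extended_Nat"
begin

text \<open>
  A finite simple undirected graph is a \<open>pair_graph\<close>: an edge \<open>xy\<close> is represented by the two
  pairs \<open>(x, y)\<close> and \<open>(y, x)\<close> in \<open>parcs G\<close>. The definitions below are intended for such graphs.
\<close>

definition cartesian_product ::
    "'a pair_pre_digraph \<Rightarrow> 'b pair_pre_digraph \<Rightarrow> ('a \<times> 'b) pair_pre_digraph" (infixr \<open>\<box>\<close> 70) where
  "G \<box> H = \<lparr> pverts = pverts G \<times> pverts H,
     parcs = {((x1, y1), (x2, y2)).
       x1 \<in> pverts G \<and> x1 = x2 \<and> (y1, y2) \<in> parcs H \<or>
       y1 \<in> pverts H \<and> y1 = y2 \<and> (x1, x2) \<in> parcs G} \<rparr>"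

definition open_nbhd :: "'a pair_pre_digraph \<Rightarrow> 'a \<Rightarrow> 'a set" where
  "open_nbhd G u = {w. (u, w) \<in> parcs G}"

definition closed_nbhd :: "'a pair_pre_digraph \<Rightarrow> 'a set \<Rightarrow> 'a set" where
  "closed_nbhd G S = S \<union> (\<Union>u\<in>S. open_nbhd G u)"

definition dominating_set :: "'a pair_pre_digraph \<Rightarrow> 'a set \<Rightarrow> bool" where
  "dominating_set G S \<longleftrightarrow> S \<subseteq> pverts G \<and> closed_nbhd G S = pverts G"

definition domination_number :: "'a pair_pre_digraph \<Rightarrow> nat" where
  "domination_number G = Min {card S | S. dominating_set G S}"

fun pd_observed :: "'a pair_pre_digraph \<Rightarrow> 'a set \<Rightarrow> nat \<Rightarrow> 'a set" where
  "pd_observed G S 0 = S"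
| "pd_observed G S (Suc 0) = closed_nbhd G S"
| "pd_observed G S (Suc (Suc i)) =
     pd_observed G S (Suc i) \<union>
     {w \<in> pverts G - pd_observed G S (Suc i).
        \<exists>u \<in> pd_observed G S (Suc i). open_nbhd G u - pd_observed G S (Suc i) = {w}}"

definition power_dominating_set :: "'a pair_pre_digraph \<Rightarrow> 'a set \<Rightarrow> bool" where
  "power_dominating_set G S \<longleftrightarrow>
     S \<noteq> {} \<and> S \<subseteq> pverts G \<and> (\<exists>t. pd_observed G S t = pverts G)"

definition power_domination_number :: "'a pair_pre_digraph \<Rightarrow> nat" where
  "power_domination_number G = Min {card S | S. power_dominating_set G S}"

definition pd_prop_time :: "'a pair_pre_digraph \<Rightarrow> 'a set \<Rightarrow> enat" where
  "pd_prop_time G S =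
     (if power_dominating_set G S
      then enat (LEAST t. 0 < t \<and> pd_observed G S t = pverts G) else \<infinity>)"

definition product_power_throttling :: "'a pair_pre_digraph \<Rightarrow> enat" where
  "product_power_throttling G =
     Min {enat (card S) * pd_prop_time G S | S. S \<noteq> {} \<and> S \<subseteq> pverts G}"

lemma pair_graph_cartesian_product:
  assumes "pair_graph G" "pair_graph H"
  shows "pair_graph (G \<box> H)"
proof -
  interpret G: pair_graph G by fact
  interpret H: pair_graph H by fact
  have sub: "parcs (G \<box> H) \<subseteq> (pverts G \<times> pverts H) \<times> (pverts G \<times> pverts H)"
    by (auto simp: cartesian_product_def dest: G.wellformed' H.wellformed')
  have fin: "finite (pverts G \<times> pverts H)"
    by (simp add: G.pair_finite_verts H.pair_finite_verts)
  have "sym (parcs G)" "sym (parcs H)"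
    using G.pair_sym_arcs H.pair_sym_arcs by (simp_all add: symmetric_def)
  then have symm: "symmetric (with_proj (G \<box> H))"
    unfolding symmetric_def by (auto simp: cartesian_product_def sym_def)
  show ?thesis
  proof
    show "fst e \<in> pverts (G \<box> H)" "snd e \<in> pverts (G \<box> H)" if "e \<in> parcs (G \<box> H)" for e
      using that by (auto simp: cartesian_product_def dest: G.wellformed' H.wellformed')
    show "finite (pverts (G \<box> H))"
      using fin by (simp add: cartesian_product_def)
    show "finite (parcs (G \<box> H))"
      using sub fin by (meson finite_SigmaI finite_subset)
    show "fst e \<noteq> snd e" if "e \<in> parcs (G \<box> H)" for e
      using that by (auto simp: cartesian_product_def dest: G.pair_no_loops H.pair_no_loops)
    show "symmetric (with_proj (G \<box> H))" by (rule symm)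
  qed
qed

end

theory Submission
  imports Defs
begin

text \<open>
  Two vertices of \<open>K\<^sub>n \<box> K\<^sub>m\<close> are adjacent iff they differ in exactly one coordinate, so the vertices
  not dominated by \<open>S\<close> form a rectangle \<open>R \<times> C\<close>, where \<open>R\<close> and \<open>C\<close> consist of the rows and columns
  missed by \<open>S\<close>. Hence a dominating set meets every row or every column and has at least \<open>n\<close>
  elements. If \<open>S\<close> has at most \<open>n - 2\<close> elements, then \<open>R\<close> and \<open>C\<close> both have at least two elements;
  every observed vertex then has either none or at least two neighbours in \<open>R \<times> C\<close>, and no
  propagation ever takes place. Conversely, a column with one vertex removed propagates in a single
  step after domination. For throttling, a set with propagation time \<open>1\<close> dominates and costs at
  least \<open>n\<close>, and any other power dominating set costs at least \<open>2 (n - 1)\<close>, which is at least \<open>n\<close>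
  unless \<open>n = 1\<close>.
\<close>

locale complete_product =
  fixes G :: "'a pair_pre_digraph" and H :: "'b pair_pre_digraph" and n m :: nat
  assumes complete_G: "complete_digraph n (with_proj G)"
    and complete_H: "complete_digraph m (with_proj H)"
    and n_le_m: "n \<le> m"
begin

section \<open>Adjacency and closed neighborhoods in the product\<close>

lemma finite_pverts: "finite (pverts G)" "finite (pverts H)"
  and card_pverts: "card (pverts G) = n" "card (pverts H) = m"
  and parcs_iff:
    "(x, x') \<in> parcs G \<longleftrightarrow> x \<in> pverts G \<and> x' \<in> pverts G \<and> x \<noteq> x'"
    "(y, y') \<in> parcs H \<longleftrightarrow> y \<in> pverts H \<and> y' \<in> pverts H \<and> y \<noteq> y'"
proof -
  interpret G: graph "with_proj G"
    using complete_G by (simp add: complete_digraph_def)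
  interpret H: graph "with_proj H"
    using complete_H by (simp add: complete_digraph_def)
  show "finite (pverts G)" "finite (pverts H)"
    using G.finite_verts H.finite_verts by simp_all
  show "card (pverts G) = n" "card (pverts H) = m"
    "(x, x') \<in> parcs G \<longleftrightarrow> x \<in> pverts G \<and> x' \<in> pverts G \<and> x \<noteq> x'"
    "(y, y') \<in> parcs H \<longleftrightarrow> y \<in> pverts H \<and> y' \<in> pverts H \<and> y \<noteq> y'"
    using complete_G complete_H
    by (auto simp: complete_digraph_def arcs_ends_def arc_to_ends_def set_eq_iff image_iff)
qed

lemma pverts_product: "pverts (G \<box> H) = pverts G \<times> pverts H"
  by (simp add: cartesian_product_def)

lemma finite_pverts_product: "finite (pverts (G \<box> H))"
  by (simp add: pverts_product finite_pverts)

lemma mem_open_nbhd_iff: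
  "(x', y') \<in> open_nbhd (G \<box> H) (x, y) \<longleftrightarrow>
     (x, y) \<in> pverts (G \<box> H) \<and> (x', y') \<in> pverts (G \<box> H) \<and> (x = x') \<noteq> (y = y')"
  by (auto simp: open_nbhd_def cartesian_product_def parcs_iff)

lemma closed_nbhd_eq:
  assumes "S \<subseteq> pverts (G \<box> H)"
  shows "closed_nbhd (G \<box> H) S =
    pverts (G \<box> H) - (pverts G - fst ` S) \<times> (pverts H - snd ` S)"
proof (rule set_eqI)
  fix w :: "'a \<times> 'b"
  obtain x y where w: "w = (x, y)" by (cases w)
  have "w \<in> closed_nbhd (G \<box> H) S \<longleftrightarrow>
      w \<in> S \<or> (\<exists>x' y'. (x', y') \<in> S \<and> w \<in> open_nbhd (G \<box> H) (x', y'))"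
    unfolding closed_nbhd_def by auto
  \<comment> \<open>Agreement in exactly one coordinate is adjacency and agreement in both is
    membership in \<open>S\<close>, so the two alternatives merge into an inclusive
    disjunction.\<close>
  also have "\<dots> \<longleftrightarrow> w \<in> pverts (G \<box> H) \<and> (\<exists>x' y'. (x', y') \<in> S \<and> (x' = x \<or> y' = y))"
    using assms unfolding w mem_open_nbhd_iff by blast
  also have "\<dots> \<longleftrightarrow> w \<in> pverts (G \<box> H) - (pverts G - fst ` S) \<times> (pverts H - snd ` S)"
    unfolding w by (force simp: pverts_product)
  finally show "w \<in> closed_nbhd (G \<box> H) S \<longleftrightarrow> \<dots>" .
qed

section \<open>Lower bounds on dominating and power dominating sets\<close>

lemma card_missed_ge:
  assumes "S \<subseteq> pverts (G \<box> H)"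
  shows "n - card S \<le> card (pverts G - fst ` S)" "n - card S \<le> card (pverts H - snd ` S)"
proof -
  have fin: "finite S"
    using assms finite_pverts_product finite_subset by blast
  have "card (fst ` S) \<le> card S" "card (snd ` S) \<le> card S"
    using fin by (simp_all add: card_image_le)
  moreover have "n - card (fst ` S) \<le> card (pverts G - fst ` S)"
    using diff_card_le_card_Diff[of "fst ` S" "pverts G"] fin by (simp add: card_pverts)
  moreover have "m - card (snd ` S) \<le> card (pverts H - snd ` S)"
    using diff_card_le_card_Diff[of "snd ` S" "pverts H"] fin by (simp add: card_pverts)
  ultimately show "n - card S \<le> card (pverts G - fst ` S)"
    "n - card S \<le> card (pverts H - snd ` S)"
    using n_le_m by linarith+
qed

lemma dominating_set_card_ge:
  assumes "dominating_set (G \<box> H) S"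
  shows "n \<le> card S"
proof (rule ccontr)
  assume "\<not> n \<le> card S"
  moreover have S: "S \<subseteq> pverts (G \<box> H)" and "closed_nbhd (G \<box> H) S = pverts (G \<box> H)"
    using assms by (auto simp: dominating_set_def)
  ultimately have "card (pverts G - fst ` S) \<noteq> 0" "card (pverts H - snd ` S) \<noteq> 0"
    using card_missed_ge[OF S] by linarith+
  then have "pverts G - fst ` S \<noteq> {}" "pverts H - snd ` S \<noteq> {}"
    by (auto simp only: card.empty)
  then obtain x y where "x \<in> pverts G - fst ` S" "y \<in> pverts H - snd ` S"
    by blast
  then have "(x, y) \<in> pverts (G \<box> H)" "(x, y) \<notin> closed_nbhd (G \<box> H) S"
    unfolding closed_nbhd_eq[OF S] by (auto simp: pverts_product)
  then show False
    using \<open>closed_nbhd (G \<box> H) S = pverts (G \<box> H)\<close> by simp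
qed

text \<open>The index starts at \<open>Suc i\<close> because stage 0 is \<open>S\<close> itself; the
  claim is that stage 1 is already a fixed point.\<close>

lemma pd_observed_stuck:
  assumes S: "S \<subseteq> pverts (G \<box> H)" and small: "card S + 2 \<le> n"
  shows "pd_observed (G \<box> H) S (Suc i) = closed_nbhd (G \<box> H) S"
proof (induction i)
  case 0
  show ?case by simp
next
  case (Suc i)
  define R C where "R = pverts G - fst ` S" and "C = pverts H - snd ` S"
  have N: "closed_nbhd (G \<box> H) S = pverts (G \<box> H) - R \<times> C"
    unfolding R_def C_def by (rule closed_nbhd_eq[OF S])
  have "2 \<le> card R" "2 \<le> card C"
    using card_missed_ge[OF S] small unfolding R_def C_def by linarith+
  then have "\<not> R \<subseteq> {x}" "\<not> C \<subseteq> {y}" for x y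
    using card_mono[of "{x}" R] card_mono[of "{y}" C] by auto
  then have other: "\<exists>x'\<in>R. x' \<noteq> x" "\<exists>y'\<in>C. y' \<noteq> y" for x y
    by blast+
  have "open_nbhd (G \<box> H) u - (pverts (G \<box> H) - R \<times> C) \<noteq> {w}"
    if "u \<in> pverts (G \<box> H) - R \<times> C" for u w
  proof
    assume eq: "open_nbhd (G \<box> H) u - (pverts (G \<box> H) - R \<times> C) = {w}"
    obtain x y a b where u: "u = (x, y)" and w: "w = (a, b)"
      by (cases u, cases w)
    \<comment> \<open>The left-hand equivalence is adjacency to \<open>u\<close>, so inside the
      missed rectangle \<open>(a, b)\<close> would be the only neighbor of \<open>u\<close>.\<close>
    have iff: "(x = x' \<longleftrightarrow> y \<noteq> y') \<longleftrightarrow> x' = a \<and> y' = b" if "x' \<in> R" "y' \<in> C" for x' y'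
    proof -
      have "(x', y') \<in> pverts (G \<box> H)"
        using that by (auto simp: pverts_product R_def C_def)
      moreover have "(x', y') \<in> open_nbhd (G \<box> H) u - (pverts (G \<box> H) - R \<times> C) \<longleftrightarrow>
          x' = a \<and> y' = b"
        unfolding eq w by simp
      ultimately show ?thesis
        using that \<open>u \<in> _\<close> unfolding u by (auto simp: mem_open_nbhd_iff)
    qed
    have ab: "a \<in> R" "b \<in> C"
      using eq unfolding u w by (auto simp: mem_open_nbhd_iff set_eq_iff)
    show False
    proof (cases "x \<in> R")
      case True
      \<comment> \<open>Here \<open>u\<close> is adjacent to every \<open>(x, y')\<close> with
        \<open>y' \<in> C\<close>, so a second element of \<open>C\<close> gives a second unobserved
        neighbor.\<close>
      then have "y \<notin> C" using that u by blast
      then show False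
        using iff[OF True] other(2)[of b] by blast
    next
      case False
      then have "x \<noteq> a" using ab by blast
      \<comment> \<open>Now \<open>u\<close> lies in column \<open>b\<close> outside
        \<open>R\<close>, hence is adjacent to \<open>(x', b)\<close> for every
        \<open>x' \<in> R\<close>, not only for \<open>a\<close>.\<close>
      then have "y = b" using iff[OF ab] by blast
      moreover obtain x' where "x' \<in> R" "x' \<noteq> a" using other(1) by blast
      ultimately show False using iff[OF \<open>x' \<in> R\<close> ab(2)] False by blast
    qed
  qed
  then show ?case
    by (simp add: Suc.IH[unfolded N] N)
qed

text \<open>Below this size nothing is observed after the first stage, so power domination would
  amount to domination, which takes \<open>n\<close> vertices.\<close>

lemma power_dominating_set_card_ge:
  assumes "power_dominating_set (G \<box> H) S" and "2 \<le> n"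
  shows "n - 1 \<le> card S"
proof (rule ccontr)
  assume "\<not> n - 1 \<le> card S"
  then have small: "card S + 2 \<le> n" by linarith
  obtain t where S: "S \<subseteq> pverts (G \<box> H)" and t: "pd_observed (G \<box> H) S t = pverts (G \<box> H)"
    using assms(1) by (auto simp: power_dominating_set_def)
  have "closed_nbhd (G \<box> H) S = pverts (G \<box> H)"
  proof (cases t)
    case 0
    then have "S = pverts (G \<box> H)" using t by simp
    then show ?thesis using closed_nbhd_eq[OF S] S by (auto simp: closed_nbhd_def)
  next
    case (Suc i)
    then show ?thesis using pd_observed_stuck[OF S small, of i] t by simp
  qed
  then have "dominating_set (G \<box> H) S"
    using S by (simp add: dominating_set_def)
  then show False
    using dominating_set_card_ge small by fastforce
qed

section \<open>Sets attaining the bounds\<close>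

lemma ex_dominating_set:
  assumes "1 \<le> n"
  obtains S where "dominating_set (G \<box> H) S" "card S = n"
proof -
  obtain b where b: "b \<in> pverts H"
    using assms n_le_m card_pverts(2) by fastforce
  define S where "S = pverts G \<times> {b}"
  have S: "S \<subseteq> pverts (G \<box> H)" "fst ` S = pverts G"
    using b by (auto simp: S_def pverts_product)
  then have "dominating_set (G \<box> H) S"
    by (simp add: dominating_set_def closed_nbhd_eq)
  moreover have "card S = n"
    by (simp add: S_def card_cartesian_product card_pverts)
  ultimately show ?thesis by (rule that)
qed

lemma ex_power_dominating_set:
  assumes "2 \<le> n"
  obtains S where "power_dominating_set (G \<box> H) S" "card S = n - 1"
proof -
  obtain a where a: "a \<in> pverts G"
    using assms card_pverts(1) by fastforce
  obtain b where b: "b \<in> pverts H"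
    using assms n_le_m card_pverts(2) by fastforce
  define S where "S = (pverts G - {a}) \<times> {b}"
  have card_S: "card S = n - 1"
    using a by (simp add: S_def card_cartesian_product card_pverts)
  then have "S \<noteq> {}" using assms by auto
  then obtain c where c: "c \<in> pverts G" "c \<noteq> a" by (auto simp: S_def)
  have S: "S \<subseteq> pverts (G \<box> H)" using b by (auto simp: S_def pverts_product)
  have "fst ` S = pverts G - {a}" "snd ` S = {b}"
    using c by (force simp: S_def)+
  then have N: "closed_nbhd (G \<box> H) S = pverts (G \<box> H) - {a} \<times> (pverts H - {b})"
    using a closed_nbhd_eq[OF S] by auto
  have "pd_observed (G \<box> H) S (Suc (Suc 0)) = pverts (G \<box> H)"
  proof (rule antisym)
    show "pd_observed (G \<box> H) S (Suc (Suc 0)) \<subseteq> pverts (G \<box> H)"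
      by (auto simp: N)
    show "pverts (G \<box> H) \<subseteq> pd_observed (G \<box> H) S (Suc (Suc 0))"
    proof
      fix w assume w: "w \<in> pverts (G \<box> H)"
      show "w \<in> pd_observed (G \<box> H) S (Suc (Suc 0))"
      proof (cases "w \<in> closed_nbhd (G \<box> H) S")
        case False
        then obtain y where y: "w = (a, y)" "y \<in> pverts H" "y \<noteq> b"
          using w by (auto simp: N)
        \<comment> \<open>Only row \<open>a\<close> has unobserved vertices, at most one per column.
          The row \<open>c\<close> meets \<open>S\<close>, so \<open>(c, y)\<close> is observed and
          forces \<open>(a, y)\<close>.\<close>
        have "(c, y) \<in> closed_nbhd (G \<box> H) S"
          using c y by (auto simp: N pverts_product)
        moreover have "open_nbhd (G \<box> H) (c, y) - closed_nbhd (G \<box> H) S = {w}"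
          using a c y by (auto simp: N mem_open_nbhd_iff pverts_product)
        ultimately show ?thesis using w False by auto
      qed simp
    qed
  qed
  then have "power_dominating_set (G \<box> H) S"
    using S \<open>S \<noteq> {}\<close> unfolding power_dominating_set_def by blast
  then show ?thesis using card_S by (rule that)
qed

section \<open>The three parameters as minima over finite sets\<close>

lemma finite_subsets_image: "finite {f S | S. S \<subseteq> pverts (G \<box> H) \<and> P S}"
proof -
  have "{f S | S. S \<subseteq> pverts (G \<box> H) \<and> P S} \<subseteq> f ` Pow (pverts (G \<box> H))" by auto
  then show ?thesis using finite_pverts_product by (simp add: finite_subset)
qed

lemma domination_number_eq:
  assumes "1 \<le> n"
  shows "domination_number (G \<box> H) = n"
  unfolding domination_number_def
proof (rule Min_eqI)
  show "finite {card S | S. dominating_set (G \<box> H) S}"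
    unfolding dominating_set_def by (rule finite_subsets_image)
  show "n \<in> {card S | S. dominating_set (G \<box> H) S}"
  proof -
    obtain S where "dominating_set (G \<box> H) S" "card S = n"
      using ex_dominating_set[OF assms] .
    then show ?thesis by force
  qed
qed (auto intro: dominating_set_card_ge)

lemma power_domination_number_eq:
  assumes "2 \<le> n"
  shows "power_domination_number (G \<box> H) = n - 1"
  unfolding power_domination_number_def
proof (rule Min_eqI)
  show "finite {card S | S. power_dominating_set (G \<box> H) S}"
    by (rule finite_subset[OF _ finite_subsets_image[of card "power_dominating_set (G \<box> H)"]])
      (auto simp: power_dominating_set_def)
  show "n - 1 \<in> {card S | S. power_dominating_set (G \<box> H) S}"
  proof -
    obtain S where "power_dominating_set (G \<box> H) S" "card S = n - 1"
      using ex_power_dominating_set[OF assms] .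
    then show ?thesis by force
  qed
qed (use assms in \<open>auto dest: power_dominating_set_card_ge\<close>)

lemma pd_prop_time_dominating:
  assumes "dominating_set (G \<box> H) S" "S \<noteq> {}"
  shows "pd_prop_time (G \<box> H) S = 1"
proof -
  have one: "pd_observed (G \<box> H) S (Suc 0) = pverts (G \<box> H)"
    using assms by (simp add: dominating_set_def)
  then have "power_dominating_set (G \<box> H) S"
    using assms unfolding power_dominating_set_def dominating_set_def by blast
  moreover have "(LEAST t. 0 < t \<and> pd_observed (G \<box> H) S t = pverts (G \<box> H)) = 1"
    by (rule Least_equality) (use one in auto)
  ultimately show ?thesis by (simp add: pd_prop_time_def one_enat_def)
qed

lemma cost_ge:
  assumes S: "S \<subseteq> pverts (G \<box> H)" "S \<noteq> {}" and n: "1 \<le> n"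
  shows "enat n \<le> enat (card S) * pd_prop_time (G \<box> H) S"
proof -
  have pos: "1 \<le> card S"
    using S finite_subset[OF S(1) finite_pverts_product] by (simp add: Suc_leI card_gt_0_iff)
  show ?thesis
  proof (cases "power_dominating_set (G \<box> H) S")
    case False
    \<comment> \<open>The cost is infinite only because \<open>card S\<close> is positive: in
      \<open>enat\<close>, zero times infinity is zero.\<close>
    then show ?thesis using pos by (simp add: pd_prop_time_def zero_enat_def)
  next
    case True
    let ?P = "\<lambda>t. 0 < t \<and> pd_observed (G \<box> H) S t = pverts (G \<box> H)"
    define t where "t = (LEAST t. ?P t)"
    obtain t' where t': "pd_observed (G \<box> H) S t' = pverts (G \<box> H)"
      using True by (auto simp: power_dominating_set_def)
    \<comment> \<open>Power domination admits stage 0, whereas propagation time must be positive; if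
      \<open>t'\<close> is 0, then \<open>S\<close> is the whole vertex set and stage 1
      serves.\<close>
    have "?P t' \<or> ?P (Suc 0)"
    proof (cases t')
      case 0
      then have "S = pverts (G \<box> H)" using t' by simp
      then show ?thesis using closed_nbhd_eq[OF S(1)] by (auto simp: closed_nbhd_def)
    qed (use t' in simp)
    then have t: "?P t" unfolding t_def using LeastI[of ?P] by blast
    have "n \<le> card S * t"
    proof (cases "n \<le> card S")
      case True
      then show ?thesis using t by (simp add: le_trans)
    next
      case False
      then have "\<not> dominating_set (G \<box> H) S" using dominating_set_card_ge by blast
      then have "t \<noteq> Suc 0" using t S by (auto simp: dominating_set_def)
      then have "card S * 2 \<le> card S * t" using t by simp
      \<comment> \<open>For \<open>2 \<le> n\<close> this is \<open>n \<le> 2 * (n - 1)\<close>; for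
        \<open>n = 1\<close> it holds because \<open>S\<close> is nonempty.\<close>
      moreover have "n \<le> card S * 2"
        using power_dominating_set_card_ge[OF True] pos by (cases "2 \<le> n") linarith+
      ultimately show ?thesis by linarith
    qed
    then show ?thesis using True by (simp add: pd_prop_time_def t_def)
  qed
qed

lemma product_power_throttling_eq:
  assumes "1 \<le> n"
  shows "product_power_throttling (G \<box> H) = enat n"
  unfolding product_power_throttling_def
proof (rule Min_eqI)
  show "finite {enat (card S) * pd_prop_time (G \<box> H) S | S. S \<noteq> {} \<and> S \<subseteq> pverts (G \<box> H)}"
    using finite_subsets_image[of "\<lambda>S. enat (card S) * pd_prop_time (G \<box> H) S" "\<lambda>S. S \<noteq> {}"]
    by (simp add: conj_commute)
  obtain S where S: "dominating_set (G \<box> H) S" "card S = n"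
    using ex_dominating_set[OF assms] .
  then have "S \<noteq> {}" "S \<subseteq> pverts (G \<box> H)"
    using assms by (auto simp: dominating_set_def)
  moreover have "enat n = enat (card S) * pd_prop_time (G \<box> H) S"
    using pd_prop_time_dominating[OF S(1) \<open>S \<noteq> {}\<close>] S(2) by simp
  ultimately show "enat n \<in> {enat (card S) * pd_prop_time (G \<box> H) S | S.
      S \<noteq> {} \<and> S \<subseteq> pverts (G \<box> H)}"
    by blast
qed (use assms cost_ge in auto)

end

theorem proposition6p7:
  fixes G :: "'a pair_pre_digraph" and H :: "'b pair_pre_digraph" and n m :: nat
  assumes "complete_digraph n (with_proj G)" and "complete_digraph m (with_proj H)" and "n \<le> m"
  shows "(2 \<le> n \<longrightarrow> power_domination_number (G \<box> H) = n - 1) \<and>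
         (1 \<le> n \<longrightarrow> product_power_throttling (G \<box> H) = enat (domination_number (G \<box> H)) \<and>
                   domination_number (G \<box> H) = n)"
proof -
  interpret complete_product G H n m
    using assms by unfold_locales
  show ?thesis
    by (simp add: power_domination_number_eq domination_number_eq product_power_throttling_eq)
qed

end
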